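(* Let $c>0$ be a constant, and for each $N$ (large enough) let $L=L_N$ be an integer with $1\le L\le \frac{N}{\log N}$. For the random walk on the spider $\mathbf{SP}(N)$ with equal leg probabilities $1/N$, $$\lim_{N\to\infty}\mathbf{P}\big(M([(cLN\log N)^2],L)\big)=P\left(|Z|>\frac1c\right),$$ where $Z$ is a standard normal random variable and $[\cdot]$ denotes the integer part.
   Context: Spider: $\mathbf{SP}(N)$ is the graph consisting of $N$ infinite legs joined at a common vertex $\mathbf 0$ (the body). $v_N(r,j)$ denotes the vertex at height $r\in\{0,1,2,\dots\}$ on leg $j\in\{1,\dots,N\}$, with $v_N(0,1)=\dots=v_N(0,N)=\mathbf 0$. Random walk on the spider: the Markov chain $\mathbf{S}_n$, $n=0,1,2,\dots$, on these vertices with $\mathbf{S}_0=\mathbf 0$, $\mathbf{P}(\mathbf{S}_{n+1}=v_N(1,j)\mid \mathbf{S}_n=\mathbf 0)=1/N$ for each $j$, and, for $r\ge1$, $\mathbf{P}(\mathbf{S}_{n+1}=v_N(r+1,j)\mid \mathbf{S}_n=v_N(r,j))=\mathbf{P}(\mathbf{S}_{n+1}=v_N(r-1,j)\mid \mathbf{S}_n=v_N(r,j))=\tfrac12$. Local time: $\xi(v_N(r,j),n)=\#\{k:\ k\le n,\ \mathbf{S}_k=v_N(r,j)\}$. The event $M(n,L)=\{\min_{1\le j\le N}\xi(v_N(L,j),n)\ge1\}$ means that within $n$ steps the walker climbs to height at least $L$ on each of the $N$ legs. *)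

theory Defs
  imports "HOL-Probability.Probability"
begin

(* The vertices at height at least 1 are Leg r j (height r, leg j); all vertices of height 0 are
   identified with Body by spider_vertex. The values Leg 0 j are not vertices of the spider,
   and no chain started in Body visits them. *)
datatype vertex = Body | Leg nat nat

definition spider_vertex :: "nat \<Rightarrow> nat \<Rightarrow> vertex" where
  "spider_vertex r j = (if r = 0 then Body else Leg r j)"

(* Meaningful for N \<ge> 1 only: pmf_of_set is unspecified on the empty set. *)
fun spider_step :: "nat \<Rightarrow> vertex \<Rightarrow> vertex pmf" where
  "spider_step N Body = pmf_of_set (spider_vertex 1 ` {1..N})"
| "spider_step N (Leg r j) = pmf_of_set {spider_vertex (r + 1) j, spider_vertex (r - 1) j}"

definition markov_chain_from ::
  "'a measure \<Rightarrow> ('s \<Rightarrow> 's pmf) \<Rightarrow> 's \<Rightarrow> (nat \<Rightarrow> 'a \<Rightarrow> 's) \<Rightarrow> bool" where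
  "markov_chain_from M K x X \<longleftrightarrow>
     prob_space M \<and>
     (\<forall>n. X n \<in> measurable M (count_space UNIV)) \<and>
     (AE \<omega> in M. X 0 \<omega> = x) \<and>
     (\<forall>n s y. \<P>(\<omega> in M. \<forall>k\<le>n. X k \<omega> = s k) > 0 \<longrightarrow>
        \<P>(\<omega> in M. X (Suc n) \<omega> = y \<bar> \<forall>k\<le>n. X k \<omega> = s k) = pmf (K (s n)) y)"

definition spider_walk :: "nat \<Rightarrow> 'a measure \<Rightarrow> (nat \<Rightarrow> 'a \<Rightarrow> vertex) \<Rightarrow> bool" where
  "spider_walk N M S \<longleftrightarrow> markov_chain_from M (spider_step N) Body S"

definition local_time :: "(nat \<Rightarrow> 'a \<Rightarrow> vertex) \<Rightarrow> vertex \<Rightarrow> nat \<Rightarrow> 'a \<Rightarrow> nat" where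
  "local_time S v n \<omega> = card {k. k \<le> n \<and> S k \<omega> = v}"

definition climb_event ::
  "nat \<Rightarrow> 'a measure \<Rightarrow> (nat \<Rightarrow> 'a \<Rightarrow> vertex) \<Rightarrow> nat \<Rightarrow> nat \<Rightarrow> 'a set" where
  "climb_event N M S n L =
     {\<omega> \<in> space M. (MIN j\<in>{1..N}. local_time S (spider_vertex L j) n \<omega>) \<ge> 1}"

lemma spider_step_Body:
  assumes "j \<in> {1..N}"
  shows "pmf (spider_step N (spider_vertex 0 i)) (spider_vertex 1 j) = 1 / real N"
proof -
  have "card (Leg (Suc 0) ` {Suc 0..N}) = N"
    by (subst card_image) (auto simp: inj_on_def)
  then show ?thesis
    using assms by (auto simp: spider_vertex_def indicator_def)
qed

lemma spider_step_Leg: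
  assumes "r \<ge> 1"
  shows "pmf (spider_step N (spider_vertex r j)) (spider_vertex (r + 1) j) = 1 / 2"
    and "pmf (spider_step N (spider_vertex r j)) (spider_vertex (r - 1) j) = 1 / 2"
  using assms by (auto simp: spider_vertex_def)

end

(* Each departure from the body discovers a given new leg at height L with probability 1/(N L), so
   covering all legs is a coupon collector problem needing about L N log N visits to the body;
   the number of visits by time n is governed by the hitting times of the simple random walk,
   hence by |Z| sqrt n.

   For a leg j let a_j be the probability that the walk, from its current position, returns to the
   body before reaching height L on leg j (and 0 once that height has been reached). With q = 1 - 1/(N L) and
   D the number of departures from the body, a_j q^(-D) is a martingale and
   a_i a_j q^(-2 D) is a supermartingale for distinct i, j. The first fact bounds the probability
   of an uncovered leg after m + 1 visits by N q^m; a second moment argument bounds the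
   probability of covering within m visits by q^(-m) / N. With m = (1 +- eps) L N log N both vanish.
   All processes are functions of the path only, so no stopping theorem is needed: a stopped
   process is obtained by freezing the functional once the path has m + 1 visits. *)
theory Submission
  imports Defs "HOL-Real_Asymp.Real_Asymp"
begin

section \<open>The law of the trajectory of a Markov chain\<close>

instance vertex :: countable
  by countable_datatype

(* Trajectories list the visited states with the most recent one first. *)
primrec trajectory :: "(nat \<Rightarrow> 'a \<Rightarrow> 's) \<Rightarrow> nat \<Rightarrow> 'a \<Rightarrow> 's list" where
  "trajectory X 0 \<omega> = [X 0 \<omega>]"
| "trajectory X (Suc n) \<omega> = X (Suc n) \<omega> # trajectory X n \<omega>"

primrec trajectory_pmf :: "('s \<Rightarrow> 's pmf) \<Rightarrow> 's \<Rightarrow> nat \<Rightarrow> 's list pmf" where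
  "trajectory_pmf K x 0 = return_pmf [x]"
| "trajectory_pmf K x (Suc n) = bind_pmf (trajectory_pmf K x n) (\<lambda>p. map_pmf (\<lambda>y. y # p) (K (hd p)))"

lemma set_trajectory: "set (trajectory X n \<omega>) = {X k \<omega> | k. k \<le> n}"
  by (induction n) (auto simp: le_Suc_eq)

lemma length_trajectory [simp]: "length (trajectory X n \<omega>) = Suc n"
  by (induction n) auto

lemma trajectory_nth: "k \<le> n \<Longrightarrow> trajectory X n \<omega> ! (n - k) = X k \<omega>"
  by (induction n) (auto simp: le_Suc_eq Suc_diff_le)

lemma trajectory_eq_iff:
  assumes "length p = Suc n"
  shows "trajectory X n \<omega> = p \<longleftrightarrow> (\<forall>k\<le>n. X k \<omega> = p ! (n - k))"
proof
  assume "\<forall>k\<le>n. X k \<omega> = p ! (n - k)"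
  then have "trajectory X n \<omega> ! i = p ! i" if "i < Suc n" for i
    using trajectory_nth[of "n - i" n X \<omega>] that by simp
  then show "trajectory X n \<omega> = p"
    using assms by (intro nth_equalityI) auto
qed (use trajectory_nth in metis)

lemma measurable_trajectory:
  assumes "\<And>n. X n \<in> measurable M (count_space (UNIV :: 's :: countable set))"
  shows "trajectory X n \<in> measurable M (count_space UNIV)"
proof (induction n)
  case 0
  show ?case
    unfolding trajectory.simps by (rule measurable_compose[OF assms]) simp
next
  case (Suc n)
  have "(\<lambda>\<omega>. (X (Suc n) \<omega>, trajectory X n \<omega>)) \<in> measurable M (count_space UNIV \<Otimes>\<^sub>M count_space UNIV)"
    using assms Suc by (intro measurable_Pair) auto
  \<comment> \<open>Countability of the state type makes the product of the two discrete
    sigma-algebras discrete again.\<close>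
  then have "(\<lambda>\<omega>. (X (Suc n) \<omega>, trajectory X n \<omega>)) \<in> measurable M (count_space UNIV)"
    by (simp add: pair_measure_countable)
  then have "(\<lambda>\<omega>. (\<lambda>(x, p). x # p) (X (Suc n) \<omega>, trajectory X n \<omega>)) \<in> measurable M (count_space UNIV)"
    by (rule measurable_compose) simp
  then show ?case
    by simp
qed

lemma set_pmf_trajectory_length: "p \<in> set_pmf (trajectory_pmf K x n) \<Longrightarrow> length p = Suc n"
  by (induction n arbitrary: p) auto

text \<open>In the mixture over pasts \<open>q\<close> only \<open>q = p\<close> can produce the
  list \<open>y # p\<close>.\<close>

lemma pmf_trajectory_Suc:
  "pmf (trajectory_pmf K x (Suc n)) (y # p) = pmf (trajectory_pmf K x n) p * pmf (K (hd p)) y"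
proof -
  have "pmf (map_pmf (\<lambda>y. y # q) (K (hd q))) (y # p) = pmf (K (hd p)) y * indicator {p} q" for q
  proof (cases "q = p")
    case True
    then show ?thesis
      using pmf_map_inj'[of "\<lambda>y. y # q" "K (hd q)" y] by (simp add: inj_def)
  next
    case False
    then have "y # p \<notin> set_pmf (map_pmf (\<lambda>y. y # q) (K (hd q)))"
      by auto
    with False show ?thesis
      by (simp add: pmf_eq_0_set_pmf)
  qed
  then show ?thesis
    by (simp add: pmf_bind measure_pmf_single mult.commute)
qed

text \<open>Induction on \<open>n\<close>: the conditional law in \<open>markov_chain_from\<close>,
  multiplied by the probability of the past, is the recursion of
  \<open>pmf_trajectory_Suc\<close>.\<close>

lemma prob_trajectory_eq:
  fixes X :: "nat \<Rightarrow> 'a \<Rightarrow> 's :: countable"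
  assumes "markov_chain_from M K x X"
  shows "\<P>(\<omega> in M. trajectory X n \<omega> = p) = pmf (trajectory_pmf K x n) p"
proof -
  interpret prob_space M
    using assms by (simp add: markov_chain_from_def)
  have step: "\<P>(\<omega> in M. \<forall>k\<le>n. X k \<omega> = s k) > 0 \<Longrightarrow>
      \<P>(\<omega> in M. X (Suc n) \<omega> = y \<bar> \<forall>k\<le>n. X k \<omega> = s k) = pmf (K (s n)) y" for n s y
    using assms by (simp add: markov_chain_from_def)
  have X: "X k \<in> measurable M (count_space UNIV)" for k
    using assms by (simp add: markov_chain_from_def)
  have pm: "trajectory X k \<in> measurable M (count_space UNIV)" for k
    by (rule measurable_trajectory[OF X])
  have ev: "{\<omega>\<in>space M. Q (trajectory X k \<omega>)} \<in> sets M" for Q k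
    using measurable_sets[OF pm, of "Collect Q"] by (simp add: vimage_def Int_def conj_commute)
  show ?thesis
  proof (induction n arbitrary: p)
    case 0
    have "AE \<omega> in M. X 0 \<omega> = x"
      using assms by (simp add: markov_chain_from_def)
    then have "AE \<omega> in M. (trajectory X 0 \<omega> = p) \<longleftrightarrow> p = [x]"
      by eventually_elim auto
    then have "prob {\<omega>\<in>space M. trajectory X 0 \<omega> = p} = prob {\<omega>\<in>space M. p = [x]}"
      by (intro finite_measure_eq_AE ev) auto
    then show ?case
      by (auto simp: prob_space pmf_return indicator_def)
  next
    case (Suc n)
    show ?case
    proof (cases "length p = Suc (Suc n)")
      case False
      then have "pmf (trajectory_pmf K x (Suc n)) p = 0"
        unfolding pmf_eq_0_set_pmf using set_pmf_trajectory_length[of p K x "Suc n"] by blast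
      moreover have "{\<omega>\<in>space M. trajectory X (Suc n) \<omega> = p} = {}"
        using False by (auto simp del: trajectory.simps)
      ultimately show ?thesis
        by (simp only: measure_empty)
    next
      case True
      then obtain y q where p: "p = y # q" and q: "length q = Suc n"
        unfolding length_Suc_conv[of p "Suc n"] by blast
      let ?B = "{\<omega>\<in>space M. trajectory X n \<omega> = q}"
      let ?s = "\<lambda>k. q ! (n - k)"
      have B: "?B = {\<omega>\<in>space M. \<forall>k\<le>n. X k \<omega> = ?s k}"
        by (simp only: trajectory_eq_iff[OF q])
      have *: "{\<omega>\<in>space M. trajectory X (Suc n) \<omega> = p}
          = {\<omega>\<in>space M. X (Suc n) \<omega> = y \<and> (\<forall>k\<le>n. X k \<omega> = ?s k)}"
        by (simp add: p trajectory_eq_iff[OF q])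
      have hd: "?s n = hd q"
        using q by (cases q) auto
      show ?thesis
      proof (cases "prob ?B > 0")
        case pos: True
        then have "cond_prob M (\<lambda>\<omega>. X (Suc n) \<omega> = y) (\<lambda>\<omega>. \<forall>k\<le>n. X k \<omega> = ?s k)
            = pmf (K (?s n)) y"
          unfolding B by (rule step)
        then have "prob {\<omega>\<in>space M. trajectory X (Suc n) \<omega> = p} = pmf (K (hd q)) y * prob ?B"
          using pos unfolding cond_prob_def *[symmetric] B[symmetric] hd by (simp add: field_simps)
        then show ?thesis
          using Suc.IH[of q] unfolding p pmf_trajectory_Suc by simp
      next
        case False
        \<comment> \<open>The chain hypothesis says nothing about a null past; here both sides
          vanish.\<close>
        then have 0: "prob ?B = 0"
          by (simp add: zero_less_measure_iff)
        have "prob {\<omega>\<in>space M. trajectory X (Suc n) \<omega> = p} \<le> prob ?B"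
          by (rule finite_measure_mono[OF _ ev]) (auto simp: p)
        then have "prob {\<omega>\<in>space M. trajectory X (Suc n) \<omega> = p} = 0"
          using 0 measure_nonneg[of M "{\<omega>\<in>space M. trajectory X (Suc n) \<omega> = p}"] by linarith
        then show ?thesis
          using Suc.IH[of q] 0 unfolding p pmf_trajectory_Suc by simp
      qed
    qed
  qed
qed

text \<open>Measures on a countable space that agree on singletons coincide. Events of the walk on
  an arbitrary probability space thereby become events of one explicit pmf.\<close>

lemma prob_trajectory:
  fixes X :: "nat \<Rightarrow> 'a \<Rightarrow> 's :: countable"
  assumes "markov_chain_from M K x X"
  shows "\<P>(\<omega> in M. Q (trajectory X n \<omega>)) = measure_pmf.prob (trajectory_pmf K x n) (Collect Q)"
proof -
  interpret prob_space M
    using assms by (simp add: markov_chain_from_def)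
  have pm: "trajectory X n \<in> measurable M (count_space UNIV)"
    using assms by (intro measurable_trajectory) (simp add: markov_chain_from_def)
  have eq: "distr M (count_space UNIV) (trajectory X n) = measure_pmf (trajectory_pmf K x n)"
  proof (rule measure_eqI_countable[where A = UNIV])
    fix p
    have "emeasure (distr M (count_space UNIV) (trajectory X n)) {p}
        = ennreal (\<P>(\<omega> in M. trajectory X n \<omega> = p))"
      using pm by (simp add: emeasure_distr emeasure_eq_measure vimage_def Int_def conj_commute)
    then show "emeasure (distr M (count_space UNIV) (trajectory X n)) {p} = emeasure (trajectory_pmf K x n) {p}"
      by (simp add: prob_trajectory_eq[OF assms] emeasure_pmf_single)
  qed auto
  show ?thesis
    unfolding eq[symmetric] using pm by (simp add: measure_distr vimage_def Int_def conj_commute)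
qed

section \<open>Expectations of functionals of the trajectory\<close>

lemma finite_set_trajectory_pmf:
  assumes "\<And>v. finite (set_pmf (K v))"
  shows "finite (set_pmf (trajectory_pmf K x n))"
  using assms by (induction n) auto

lemma expectation_trajectory_Suc:
  fixes f :: "'s list \<Rightarrow> real"
  assumes "\<And>v. finite (set_pmf (K v))"
  shows "measure_pmf.expectation (trajectory_pmf K x (Suc n)) f =
    measure_pmf.expectation (trajectory_pmf K x n)
      (\<lambda>p. measure_pmf.expectation (K (hd p)) (\<lambda>y. f (y # p)))"
  unfolding trajectory_pmf.simps
  by (subst pmf_expectation_bind[of "set_pmf (trajectory_pmf K x n)"],
      use assms finite_set_trajectory_pmf[OF assms] in auto)
     (subst integral_measure_pmf[of "set_pmf (trajectory_pmf K x n)"],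
       use assms finite_set_trajectory_pmf[OF assms] in auto)

lemma expectation_trajectory_supermartingale:
  fixes f :: "'s list \<Rightarrow> real"
  assumes "\<And>v. finite (set_pmf (K v))"
    and "\<And>n p. p \<in> set_pmf (trajectory_pmf K x n) \<Longrightarrow>
           measure_pmf.expectation (K (hd p)) (\<lambda>y. f (y # p)) \<le> f p"
  shows "measure_pmf.expectation (trajectory_pmf K x n) f \<le> f [x]"
proof (induction n)
  case (Suc n)
  have "measure_pmf.expectation (trajectory_pmf K x (Suc n)) f \<le> measure_pmf.expectation (trajectory_pmf K x n) f"
    unfolding expectation_trajectory_Suc[OF assms(1)] using assms(2)
    by (intro integral_mono_AE integrable_measure_pmf_finite finite_set_trajectory_pmf assms(1))
       (auto simp: AE_measure_pmf_iff)
  with Suc show ?case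
    by simp
qed simp

text \<open>Here \<open>f k p\<close> plays the role of the expected final value when the path is
  \<open>p\<close> and \<open>k\<close> steps remain; the hypothesis is the backward
  equation.\<close>

lemma expectation_trajectory_backward:
  fixes f :: "nat \<Rightarrow> 's list \<Rightarrow> real"
  assumes "\<And>v. finite (set_pmf (K v))"
    and "\<And>k n p. p \<in> set_pmf (trajectory_pmf K x n) \<Longrightarrow>
           measure_pmf.expectation (K (hd p)) (\<lambda>y. f k (y # p)) = f (Suc k) p"
  shows "measure_pmf.expectation (trajectory_pmf K x n) (f k) = f (k + n) [x]"
proof (induction n arbitrary: k)
  case (Suc n)
  have "measure_pmf.expectation (trajectory_pmf K x (Suc n)) (f k)
      = measure_pmf.expectation (trajectory_pmf K x n) (f (Suc k))"
    unfolding expectation_trajectory_Suc[OF assms(1)] using assms(2)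
    by (intro integral_cong_AE) (auto simp: AE_measure_pmf_iff)
  with Suc show ?case
    by simp
qed simp

section \<open>Return probabilities as martingales\<close>

primrec height :: "vertex \<Rightarrow> nat" where
  "height Body = 0"
| "height (Leg r j) = r"

abbreviation spider_paths :: "nat \<Rightarrow> nat \<Rightarrow> vertex list pmf" where
  "spider_paths N \<equiv> trajectory_pmf (spider_step N) Body"

lemma finite_set_spider_step:
  assumes "N \<ge> 1"
  shows "finite (set_pmf (spider_step N v))"
  using assms by (cases v) auto

lemma expectation_step_Body:
  fixes f :: "vertex \<Rightarrow> real"
  assumes "N \<ge> 1"
  shows "measure_pmf.expectation (spider_step N Body) f = (\<Sum>j=1..N. f (Leg 1 j)) / N"
proof -
  have inj: "inj_on (Leg 1) A" for A
    by (auto simp: inj_on_def)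
  have "spider_vertex 1 ` {1..N} = Leg 1 ` {1..N}"
    by (auto simp: spider_vertex_def)
  then show ?thesis
    using assms by (simp add: integral_pmf_of_set sum.reindex[OF inj] card_image[OF inj] o_def del: One_nat_def)
qed

lemma expectation_step_Leg:
  fixes f :: "vertex \<Rightarrow> real"
  assumes "r \<ge> 1"
  shows "measure_pmf.expectation (spider_step N (Leg r j)) f
    = (f (Leg (Suc r) j) + f (spider_vertex (r - 1) j)) / 2"
  using assms by (auto simp: integral_pmf_of_set spider_vertex_def)

lemma spider_paths_ne:
  "p \<in> set_pmf (spider_paths N n) \<Longrightarrow> p \<noteq> []"
  using set_pmf_trajectory_length by fastforce

text \<open>The spurious values \<open>Leg 0 j\<close> never occur, because
  \<open>spider_vertex\<close> turns the downward step from height 1 into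
  \<open>Body\<close>.\<close>

lemma spider_paths_cases:
  assumes "p \<in> set_pmf (spider_paths N n)" "N \<ge> 1"
  obtains "hd p = Body" | r j where "hd p = Leg r j" "r \<ge> 1"
proof -
  have "hd p = Body \<or> (\<exists>r j. hd p = Leg r j \<and> r \<ge> 1)"
    using assms(1)
  proof (induction n arbitrary: p)
    case (Suc n)
    then obtain q where q: "q \<in> set_pmf (spider_paths N n)" "hd p \<in> set_pmf (spider_step N (hd q))"
      by auto
    show ?case
      using Suc.IH[OF q(1)] q(2) assms(2) by (auto simp: spider_vertex_def split: if_splits)
  qed simp
  then show ?thesis
    using that by blast
qed

section \<open>Departures from the body and the probability of avoiding a height\<close>

abbreviation body_visits :: "vertex list \<Rightarrow> nat" where
  "body_visits p \<equiv> count_list p Body"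

text \<open>The head of the list is the current position; a visit taking place there has not yet
  been followed by a departure.\<close>

definition departures :: "vertex list \<Rightarrow> nat" where
  "departures p = body_visits (tl p)"

lemma departures_Cons [simp]: "departures (v # p) = body_visits p"
  by (simp add: departures_def)

lemma body_visits_eq:
  "p \<noteq> [] \<Longrightarrow> body_visits p = departures p + (if hd p = Body then 1 else 0)"
  by (cases p) auto

(* The probability of returning to the body from v before visiting Leg L j; the value at heights
   above L on leg j is irrelevant. *)
definition return_prob :: "nat \<Rightarrow> nat \<Rightarrow> vertex \<Rightarrow> real" where
  "return_prob L j v = (case v of Body \<Rightarrow> 1
     | Leg r i \<Rightarrow> if i = j then max 0 (1 - real r / real L) else 1)"

definition avoid :: "nat \<Rightarrow> nat \<Rightarrow> vertex list \<Rightarrow> real" where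
  "avoid L j p = (if Leg L j \<in> set p then 0 else return_prob L j (hd p))"

lemma avoid_nonneg [simp]: "0 \<le> avoid L j p"
  and avoid_le_1 [simp]: "avoid L j p \<le> 1"
  by (auto simp: avoid_def return_prob_def split: vertex.splits)

text \<open>From height 1 on leg \<open>j\<close> the gambler's ruin probability of returning first
  is \<open>1 - 1 / L\<close>. For \<open>L = 1\<close> the step hits the target itself, in
  accordance with the factor 0.\<close>

lemma avoid_Cons_Leg_1:
  assumes "hd p = Body" "L \<ge> 1"
  shows "avoid L j (Leg 1 i # p) = avoid L j p * (if i = j then 1 - 1 / real L else 1)"
  using assms by (auto simp: avoid_def return_prob_def)

lemma sum_weight_eq:
  fixes a b :: real
  assumes "J \<subseteq> {1..N}"
  shows "(\<Sum>i=1..N. if i \<in> J then a else b) = card J * a + (real N - card J) * b"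
proof -
  have "card J \<le> N"
    using card_mono[OF _ assms] by simp
  moreover have "card ({1..N} - J) = N - card J"
    using assms by (simp add: card_Diff_subset finite_subset)
  ultimately show ?thesis
    using assms by (simp add: sum.If_cases Int_absorb1 Diff_eq[symmetric])
qed

text \<open>On a leg, \<open>return_prob\<close> is either constant or linear in the height up to
  \<open>L\<close>, hence harmonic. At the body only one of the \<open>N\<close> equally likely legs
  loses the proportion \<open>1 / L\<close>.\<close>

lemma expectation_avoid:
  assumes "p \<in> set_pmf (spider_paths N n)" "N \<ge> 1" "L \<ge> 1" "j \<in> {1..N}"
  shows "measure_pmf.expectation (spider_step N (hd p)) (\<lambda>y. avoid L j (y # p))
    = avoid L j p * (if hd p = Body then 1 - 1 / (real N * real L) else 1)"
  using assms(1,2)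
proof (cases rule: spider_paths_cases)
  case 1
  have "(\<Sum>i=1..N. if i = j then 1 - 1 / real L else 1) = real N - 1 / real L"
    using sum_weight_eq[of "{j}" N "1 - 1 / real L" 1] assms by simp
  then have "(\<Sum>i=1..N. avoid L j (Leg 1 i # p)) = avoid L j p * (real N - 1 / real L)"
    unfolding avoid_Cons_Leg_1[OF 1 assms(3)] by (simp add: sum_distrib_left[symmetric])
  then show ?thesis
    unfolding 1 expectation_step_Body[OF assms(2)] using assms by (simp add: field_simps)
next
  case (2 r i)
  have E: "measure_pmf.expectation (spider_step N (hd p)) (\<lambda>y. avoid L j (y # p))
      = (avoid L j (Leg (Suc r) i # p) + avoid L j (spider_vertex (r - 1) i # p)) / 2"
    unfolding 2(1) by (rule expectation_step_Leg[OF 2(2)])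
  show ?thesis
  proof (cases "Leg L j \<in> set p \<or> i \<noteq> j")
    case True
    then show ?thesis
      unfolding E by (auto simp: avoid_def return_prob_def spider_vertex_def 2)
  next
    case False
    then have nv: "Leg L j \<notin> set p" and [simp]: "i = j"
      by auto
    \<comment> \<open>The current vertex belongs to \<open>p\<close>, so it is not the unvisited
      target. This excludes the kink of \<open>max 0 (1 - r / L)\<close>, the only positive height
      at which that function is not harmonic.\<close>
    have "r \<noteq> L"
      using 2 nv assms(1) spider_paths_ne by (metis False hd_in_set)
    have up: "avoid L j (Leg (Suc r) i # p) = max 0 (1 - real (Suc r) / real L)"
      using nv assms(3) by (auto simp: avoid_def return_prob_def)
    have down: "avoid L j (spider_vertex (r - 1) i # p) = max 0 (1 - real (r - 1) / real L)"
      using nv 2 \<open>r \<noteq> L\<close> assms(3) by (auto simp: avoid_def return_prob_def spider_vertex_def)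
    have now: "avoid L j p = max 0 (1 - real r / real L)"
      using nv 2 by (auto simp: avoid_def return_prob_def)
    have "max 0 (1 - real (Suc r) / real L) + max 0 (1 - real (r - 1) / real L)
        = 2 * max 0 (1 - real r / real L)"
    proof (cases "r < L")
      case True
      have "max 0 (1 - real s / real L) = 1 - real s / real L" if "s \<le> L" for s
        using that assms(3) by (simp add: max_def)
      then show ?thesis
        using True 2(2) assms(3) by (simp add: of_nat_diff field_simps)
    next
      case False
      have "max 0 (1 - real s / real L) = 0" if "s \<ge> L" for s
        using that assms(3) by (simp add: max_def)
      from this[of "Suc r"] this[of r] this[of "r - 1"] show ?thesis
        using False \<open>r \<noteq> L\<close> by simp
    qed
    then show ?thesis
      unfolding E up down now using 2 by simp
  qed
qed

text \<open>At the body the factor is \<open>1 - 2 x\<close> with \<open>x = 1 / (N L)\<close>,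
  which is at most \<open>(1 - x)\<^sup>2\<close>. A step along a leg moves at most one of the two
  factors, and that one keeps its mean.\<close>

lemma expectation_avoid_mult:
  assumes "p \<in> set_pmf (spider_paths N n)" "N \<ge> 1" "L \<ge> 1" "i \<in> {1..N}" "j \<in> {1..N}" "i \<noteq> j"
  shows "measure_pmf.expectation (spider_step N (hd p)) (\<lambda>y. avoid L i (y # p) * avoid L j (y # p))
    \<le> avoid L i p * avoid L j p * (if hd p = Body then (1 - 1 / (real N * real L))\<^sup>2 else 1)"
  using assms(1,2)
proof (cases rule: spider_paths_cases)
  case 1
  have "(\<Sum>k=1..N. if k \<in> {i, j} then 1 - 1 / real L else 1) = real N - 2 / real L"
    using sum_weight_eq[of "{i, j}" N "1 - 1 / real L" 1] assms by simp
  moreover have "avoid L i (Leg 1 k # p) * avoid L j (Leg 1 k # p)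
      = avoid L i p * avoid L j p * (if k \<in> {i, j} then 1 - 1 / real L else 1)" for k
    unfolding avoid_Cons_Leg_1[OF 1 assms(3)] using assms(6) by auto
  ultimately have "(\<Sum>k=1..N. avoid L i (Leg 1 k # p) * avoid L j (Leg 1 k # p))
      = avoid L i p * avoid L j p * (real N - 2 / real L)"
    by (simp only: sum_distrib_left[symmetric])
  then have "measure_pmf.expectation (spider_step N (hd p)) (\<lambda>y. avoid L i (y # p) * avoid L j (y # p))
      = avoid L i p * avoid L j p * (1 - 2 / (real N * real L))"
    unfolding 1 expectation_step_Body[OF assms(2)] using assms by (simp add: field_simps)
  also have "\<dots> \<le> avoid L i p * avoid L j p * (1 - 1 / (real N * real L))\<^sup>2"
    by (intro mult_left_mono) (auto simp: power2_eq_square algebra_simps)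
  finally show ?thesis
    using 1 by simp
next
  case (2 r k)
  have avoid_const: "avoid L l (y # p) = avoid L l p"
    if "l \<noteq> k" "y \<in> {Leg (Suc r) k, spider_vertex (r - 1) k}" for l y
    using that 2 by (auto simp: avoid_def return_prob_def spider_vertex_def split: if_splits)
  \<comment> \<open>As \<open>i\<close> and \<open>j\<close> are distinct, one of them differs from
    the current leg \<open>k\<close>; it takes the role of \<open>a\<close>, and its factor is
    constant over the step.\<close>
  have *: "measure_pmf.expectation (spider_step N (hd p)) (\<lambda>y. avoid L a (y # p) * avoid L b (y # p))
      = avoid L a p * avoid L b p" if "a \<noteq> k" "b \<in> {1..N}" for a b
  proof -
    have "measure_pmf.expectation (spider_step N (hd p)) (\<lambda>y. avoid L a (y # p) * avoid L b (y # p))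
      = avoid L a p * measure_pmf.expectation (spider_step N (hd p)) (\<lambda>y. avoid L b (y # p))"
      unfolding 2(1) expectation_step_Leg[OF 2(2)] using that
      by (simp add: avoid_const distrib_left)
    also have "\<dots> = avoid L a p * avoid L b p"
      unfolding expectation_avoid[OF assms(1-3) that(2)] using 2 by simp
    finally show ?thesis .
  qed
  have "measure_pmf.expectation (spider_step N (hd p)) (\<lambda>y. avoid L i (y # p) * avoid L j (y # p))
      = avoid L i p * avoid L j p"
    using *[of i j] *[of j i] assms(4-6) by (cases "i = k") (auto simp: mult.commute)
  then show ?thesis
    using 2 by simp
qed

section \<open>Covering the legs versus visiting the body\<close>

lemma markov_inequality_pmf:
  fixes f :: "'b \<Rightarrow> real"
  assumes "finite (set_pmf P)" "\<And>p. p \<in> set_pmf P \<Longrightarrow> 0 \<le> f p"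
    and "\<And>p. p \<in> set_pmf P \<Longrightarrow> p \<in> A \<Longrightarrow> c \<le> f p"
  shows "c * measure_pmf.prob P A \<le> measure_pmf.expectation P f"
proof -
  have "measure_pmf.expectation P (\<lambda>p. c * indicator A p) \<le> measure_pmf.expectation P f"
    using assms
    by (intro integral_mono_AE integrable_measure_pmf_finite)
       (auto simp: AE_measure_pmf_iff indicator_def)
  then show ?thesis
    by simp
qed

lemma expectation_pmf_mono:
  fixes f g :: "'b \<Rightarrow> real"
  assumes "finite (set_pmf P)" "\<And>x. f x \<le> g x"
  shows "measure_pmf.expectation P f \<le> measure_pmf.expectation P g"
  using assms by (intro integral_mono integrable_measure_pmf_finite)

lemma avoid_start [simp]: "avoid L j [Body] = 1"
  by (simp add: avoid_def return_prob_def)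

context
  fixes N L :: nat and q :: real
  assumes N: "N \<ge> 2" and L: "L \<ge> 1"
  defines "q \<equiv> 1 - 1 / (real N * real L)"
begin

lemma q_bounds: "0 < q" "q \<le> 1"
proof -
  \<comment> \<open>Having at least two legs keeps \<open>q\<close> positive, so that powers of
    \<open>1 / q\<close> make sense even for \<open>L = 1\<close>.\<close>
  have "2 * 1 \<le> real N * real L"
    using N L by (intro mult_mono) auto
  then show "0 < q" "q \<le> 1"
    by (auto simp: q_def field_simps)
qed

lemma finite_spider_paths: "finite (set_pmf (spider_paths N n))"
  using N by (intro finite_set_trajectory_pmf finite_set_spider_step) simp

lemma finite_step: "finite (set_pmf (spider_step N v))"
  using N by (intro finite_set_spider_step) simp

lemma integrable_step: "integrable (measure_pmf (spider_step N v)) (f :: vertex \<Rightarrow> real)"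
  by (rule integrable_measure_pmf_finite[OF finite_step])

text \<open>The weight after the step does not depend on \<open>y\<close>; it gains a factor
  \<open>1 / q\<close> exactly at the body, cancelling the loss \<open>q\<close> of
  \<open>expectation_avoid\<close>.\<close>

lemma expectation_avoid_weighted:
  assumes p: "p \<in> set_pmf (spider_paths N n)" and j: "j \<in> {1..N}"
  shows "measure_pmf.expectation (spider_step N (hd p))
      (\<lambda>y. avoid L j (y # p) * (1 / q) ^ departures (y # p))
    = avoid L j p * (1 / q) ^ departures p"
  using expectation_avoid[OF p _ L j] N q_bounds body_visits_eq[OF spider_paths_ne[OF p]]
  by (simp add: q_def[symmetric])

lemma expectation_avoid_mult_weighted:
  assumes p: "p \<in> set_pmf (spider_paths N n)" and ij: "i \<in> {1..N}" "j \<in> {1..N}" "i \<noteq> j"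
  shows "measure_pmf.expectation (spider_step N (hd p))
      (\<lambda>y. avoid L i (y # p) * avoid L j (y # p) * (1 / q) ^ (2 * departures (y # p)))
    \<le> avoid L i p * avoid L j p * (1 / q) ^ (2 * departures p)"
proof -
  let ?e = "if hd p = Body then 1 else 0 :: nat"
  have "measure_pmf.expectation (spider_step N (hd p))
      (\<lambda>y. avoid L i (y # p) * avoid L j (y # p) * (1 / q) ^ (2 * departures (y # p)))
    \<le> avoid L i p * avoid L j p * (if hd p = Body then q\<^sup>2 else 1) * (1 / q) ^ (2 * body_visits p)"
    using expectation_avoid_mult[OF p _ L ij] N q_bounds
    by (auto simp: q_def[symmetric] intro!: mult_right_mono)
  also have "\<dots> = avoid L i p * avoid L j p * (1 / q) ^ (2 * departures p)"
    using body_visits_eq[OF spider_paths_ne[OF p]] q_bounds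
    by (simp add: power2_eq_square)
  finally show ?thesis .
qed

text \<open>Markov's inequality for the martingale frozen at visit \<open>m + 1\<close>: its initial
  value is 1, and it equals \<open>(1 / q) ^ m\<close> on the event in question.\<close>

lemma prob_uncovered_leg:
  assumes j: "j \<in> {1..N}"
  shows "measure_pmf.prob (spider_paths N n) {p. m < body_visits p \<and> Leg L j \<notin> set p} \<le> q ^ m"
proof -
  define f where "f p = (if m < body_visits p then (if Leg L j \<in> set p then 0 else 1) * (1 / q) ^ m
      else avoid L j p * (1 / q) ^ departures p)" for p
  have "(1 / q) ^ m * measure_pmf.prob (spider_paths N n) {p. m < body_visits p \<and> Leg L j \<notin> set p}
      \<le> measure_pmf.expectation (spider_paths N n) f"
    using q_bounds by (intro markov_inequality_pmf finite_spider_paths) (auto simp: f_def)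
  also have "\<dots> \<le> f [Body]"
  proof (rule expectation_trajectory_supermartingale[OF finite_step])
    fix n p assume p: "p \<in> set_pmf (spider_paths N n)"
    show "measure_pmf.expectation (spider_step N (hd p)) (\<lambda>y. f (y # p)) \<le> f p"
    proof (cases "m < body_visits p")
      case True
      \<comment> \<open>After freezing, a longer path can only turn the indicator of an uncovered
        leg from 1 to 0.\<close>
      then have "f (y # p) \<le> f p" for y
        using q_bounds by (auto simp: f_def)
      then have "measure_pmf.expectation (spider_step N (hd p)) (\<lambda>y. f (y # p))
          \<le> measure_pmf.expectation (spider_step N (hd p)) (\<lambda>y. f p)"
        by (intro expectation_pmf_mono finite_step)
      then show ?thesis
        by simp
    next
      case False
      have "f (y # p) = avoid L j (y # p) * (1 / q) ^ departures (y # p)" for y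
      proof (cases "m < body_visits (y # p)")
        case True
        \<comment> \<open>The threshold is crossed by stepping onto the body after exactly
          \<open>m\<close> departures. There \<open>avoid\<close> is the indicator of an uncovered
          leg, so the two branches of \<open>f\<close> agree.\<close>
        then have "y = Body" "body_visits p = m"
          using False by (auto split: if_splits)
        then show ?thesis
          by (simp add: f_def avoid_def return_prob_def)
      next
        case False
        then show ?thesis
          by (simp only: f_def if_False)
      qed
      then show ?thesis
        using expectation_avoid_weighted[OF p j] False by (simp add: f_def)
    qed
  qed
  also have "\<dots> = 1"
    by (simp add: f_def departures_def)
  finally show ?thesis
    using q_bounds by (simp add: field_simps)
qed

lemma prob_uncovered:
  "measure_pmf.prob (spider_paths N n) {p. m < body_visits p \<and> (\<exists>j\<in>{1..N}. Leg L j \<notin> set p)}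
    \<le> N * q ^ m"
proof -
  have "{p. m < body_visits p \<and> (\<exists>j\<in>{1..N}. Leg L j \<notin> set p)}
      = (\<Union>j\<in>{1..N}. {p. m < body_visits p \<and> Leg L j \<notin> set p})"
    by auto
  then have "measure_pmf.prob (spider_paths N n)
        {p. m < body_visits p \<and> (\<exists>j\<in>{1..N}. Leg L j \<notin> set p)}
      \<le> (\<Sum>j=1..N. measure_pmf.prob (spider_paths N n) {p. m < body_visits p \<and> Leg L j \<notin> set p})"
    by (simp add: measure_pmf.finite_measure_subadditive_finite)
  also have "\<dots> \<le> (\<Sum>j=1..N. q ^ m)"
    by (intro sum_mono prob_uncovered_leg)
  finally show ?thesis
    by simp
qed

(* On paths with at most m departures this dominates (W - N)^2, where
   W is the sum over j of avoid L j p * (1 / q) ^ departures p. *)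
definition covering_variance :: "nat \<Rightarrow> vertex list \<Rightarrow> real" where
  "covering_variance m p =
     (\<Sum>i=1..N. \<Sum>j\<in>{1..N} - {i}. avoid L i p * avoid L j p * (1 / q) ^ (2 * departures p))
     + ((1 / q) ^ m - 2 * N) * (\<Sum>i=1..N. avoid L i p * (1 / q) ^ departures p) + (real N)\<^sup>2"

text \<open>Completing the square leaves \<open>(W - N)\<^sup>2\<close> plus the excess of
  \<open>(1 / q) ^ m * W\<close> over the diagonal squares. That linear term stands in for the
  squares, which in general are not supermartingales.\<close>

lemma covering_variance_nonneg:
  assumes "departures p \<le> m"
  shows "0 \<le> covering_variance m p"
proof -
  let ?a = "\<lambda>i. avoid L i p * (1 / q) ^ departures p"
  let ?W = "\<Sum>i=1..N. ?a i"
  have "(\<Sum>j\<in>{1..N} - {i}. avoid L i p * avoid L j p * (1 / q) ^ (2 * departures p))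
      = ?a i * (?W - ?a i)" if "i \<in> {1..N}" for i
  proof -
    have "(\<Sum>j\<in>{1..N} - {i}. avoid L i p * avoid L j p * (1 / q) ^ (2 * departures p))
        = (\<Sum>j\<in>{1..N} - {i}. ?a i * ?a j)"
      unfolding mult_2 power_add by (simp only: mult_ac)
    also have "\<dots> = ?a i * (\<Sum>j\<in>{1..N} - {i}. ?a j)"
      by (simp only: sum_distrib_left)
    finally show ?thesis
      using that by (simp only: sum_diff1 finite_atLeastAtMost if_True)
  qed
  then have "(\<Sum>i=1..N. \<Sum>j\<in>{1..N} - {i}. avoid L i p * avoid L j p * (1 / q) ^ (2 * departures p))
      = (\<Sum>i=1..N. ?a i * (?W - ?a i))"
    by (rule sum.cong[OF refl])
  also have "\<dots> = ?W\<^sup>2 - (\<Sum>i=1..N. (?a i)\<^sup>2)"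
    by (simp add: right_diff_distrib sum_subtractf power2_eq_square sum_distrib_right)
  finally have *: "covering_variance m p
      = (?W - N)\<^sup>2 + ((1 / q) ^ m * ?W - (\<Sum>i=1..N. (?a i)\<^sup>2))"
    unfolding covering_variance_def by (simp add: power2_eq_square algebra_simps)
  have "(?a i)\<^sup>2 \<le> (1 / q) ^ m * ?a i" for i
  proof -
    have "?a i \<le> 1 * (1 / q) ^ m"
      using q_bounds assms by (intro mult_mono power_increasing) auto
    then show ?thesis
      unfolding power2_eq_square using q_bounds by (intro mult_right_mono) auto
  qed
  then have "(\<Sum>i=1..N. (?a i)\<^sup>2) \<le> (1 / q) ^ m * ?W"
    by (simp only: sum_distrib_left sum_mono)
  then show ?thesis
    unfolding * by simp
qed

text \<open>The off-diagonal products are supermartingales. The coefficient of the linear sum may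
  have either sign, so there the exact martingale property is used.\<close>

lemma expectation_covering_variance:
  assumes p: "p \<in> set_pmf (spider_paths N n)"
  shows "measure_pmf.expectation (spider_step N (hd p)) (\<lambda>y. covering_variance m (y # p))
    \<le> covering_variance m p"
  unfolding covering_variance_def
  by (simp add: integrable_step expectation_avoid_weighted[OF p] del: departures_Cons)
     (intro sum_mono expectation_avoid_mult_weighted[OF p], auto)

text \<open>A Chebyshev argument: once all legs are covered every \<open>avoid\<close> term vanishes
  and \<open>covering_variance\<close> equals \<open>N\<^sup>2\<close>, while its initial value is
  below \<open>N * (1 / q) ^ m\<close>. The process is set to 0 from visit \<open>m + 1\<close>
  on.\<close>

lemma prob_covered:
  "measure_pmf.prob (spider_paths N n) {p. body_visits p \<le> m \<and> (\<forall>j\<in>{1..N}. Leg L j \<in> set p)}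
    \<le> (1 / q) ^ m / N"
proof -
  define f where "f p = (if body_visits p \<le> m then covering_variance m p else 0)" for p
  have departures_le: "departures p \<le> m" if "body_visits p \<le> m" for p
    using that by (cases p) (auto split: if_splits simp: departures_def)
  have f_nonneg: "0 \<le> f p" for p
    using covering_variance_nonneg departures_le by (simp add: f_def)
  have covered: "covering_variance m p = (real N)\<^sup>2" if "\<forall>j\<in>{1..N}. Leg L j \<in> set p" for p
  proof -
    have "avoid L j p = 0" if "j \<in> {1..N}" for j
      using \<open>\<forall>j\<in>{1..N}. Leg L j \<in> set p\<close> that by (auto simp: avoid_def)
    then show ?thesis
      by (simp add: covering_variance_def)
  qed
  have "(real N)\<^sup>2 * measure_pmf.prob (spider_paths N n)
          {p. body_visits p \<le> m \<and> (\<forall>j\<in>{1..N}. Leg L j \<in> set p)}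
      \<le> measure_pmf.expectation (spider_paths N n) f"
    using covered f_nonneg
    by (intro markov_inequality_pmf finite_spider_paths) (auto simp: f_def)
  also have "\<dots> \<le> f [Body]"
  proof (rule expectation_trajectory_supermartingale[OF finite_step])
    fix n p assume p: "p \<in> set_pmf (spider_paths N n)"
    show "measure_pmf.expectation (spider_step N (hd p)) (\<lambda>y. f (y # p)) \<le> f p"
    proof (cases "body_visits p \<le> m")
      case True
      \<comment> \<open>Even when this step makes visit \<open>m + 1\<close> there are only
        \<open>m\<close> departures, so the variance is still nonnegative and replacing it by 0
        lowers it.\<close>
      then have "f (y # p) \<le> covering_variance m (y # p)" for y
        using covering_variance_nonneg[of "y # p" m] by (simp add: f_def)
      then have "measure_pmf.expectation (spider_step N (hd p)) (\<lambda>y. f (y # p))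
          \<le> measure_pmf.expectation (spider_step N (hd p)) (\<lambda>y. covering_variance m (y # p))"
        by (intro expectation_pmf_mono finite_step)
      then show ?thesis
        using expectation_covering_variance[OF p, of m] True by (simp add: f_def)
    next
      case False
      then have "f (y # p) = 0" for y
        by (simp add: f_def)
      with False show ?thesis
        by (simp add: f_def)
    qed
  qed
  also have "\<dots> \<le> N * (1 / q) ^ m"
  proof -
    \<comment> \<open>All \<open>avoid\<close> values start at 1: the sum is
      \<open>N (N - 1) + ((1 / q) ^ m - 2 N) N + N\<^sup>2\<close>.\<close>
    have "covering_variance m [Body] = N * (1 / q) ^ m - N"
      using N by (simp add: covering_variance_def departures_def power2_eq_square of_nat_diff algebra_simps)
    then show ?thesis
      using q_bounds by (simp add: f_def)
  qed
  finally have "real N * (real N * measure_pmf.prob (spider_paths N n)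
          {p. body_visits p \<le> m \<and> (\<forall>j\<in>{1..N}. Leg L j \<in> set p)}) \<le> real N * (1 / q) ^ m"
    by (simp add: power2_eq_square mult.assoc)
  then have "real N * measure_pmf.prob (spider_paths N n)
          {p. body_visits p \<le> m \<and> (\<forall>j\<in>{1..N}. Leg L j \<in> set p)} \<le> (1 / q) ^ m"
    using N mult_le_cancel_left_pos[of "real N"] by simp
  then show ?thesis
    using N pos_le_divide_eq[of "real N"] by (simp add: mult.commute[of _ "real N"])
qed

end

section \<open>Visits to the body and the simple random walk\<close>

primrec srw :: "nat \<Rightarrow> int pmf" where
  "srw 0 = return_pmf 0"
| "srw (Suc n) = bind_pmf (srw n) (\<lambda>x. map_pmf (\<lambda>s. x + s) (pmf_of_set {-1, 1}))"

lemma finite_set_srw: "finite (set_pmf (srw n))"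
  by (induction n) auto

text \<open>Stated for Banach space values so as to serve both real indicators and complex
  characteristic functions.\<close>

lemma expectation_srw_Suc:
  fixes f :: "int \<Rightarrow> 'b :: {banach, second_countable_topology}"
  shows "measure_pmf.expectation (srw (Suc n)) f
    = measure_pmf.expectation (srw n) (\<lambda>x. (1 / 2) *\<^sub>R (f (x - 1) + f (x + 1)))"
proof -
  have step: "measure_pmf.expectation (map_pmf (\<lambda>s. x + s) (pmf_of_set {-1, 1})) f
      = (1 / 2) *\<^sub>R (f (x - 1) + f (x + 1))" for x
    by (subst integral_map_pmf, subst integral_measure_pmf[of "{-1, 1}"])
       (auto simp: scaleR_add_right)
  have "measure_pmf.expectation (srw (Suc n)) f
      = (\<Sum>x\<in>set_pmf (srw n). pmf (srw n) x *\<^sub>R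
          measure_pmf.expectation (map_pmf (\<lambda>s. x + s) (pmf_of_set {-1, 1})) f)"
    unfolding srw.simps by (rule pmf_expectation_bind) (auto simp: finite_set_srw)
  also have "\<dots> = measure_pmf.expectation (srw n) (\<lambda>x. (1 / 2) *\<^sub>R (f (x - 1) + f (x + 1)))"
    unfolding step by (rule integral_measure_pmf[symmetric]) (auto simp: finite_set_srw)
  finally show ?thesis .
qed

lemma prob_srw_Suc:
  "measure_pmf.prob (srw (Suc n)) A
    = (measure_pmf.prob (srw n) {x. x - 1 \<in> A} + measure_pmf.prob (srw n) {x. x + 1 \<in> A}) / 2"
proof -
  have "measure_pmf.prob (srw (Suc n)) A = measure_pmf.expectation (srw (Suc n)) (indicator A)"
    by simp
  also have "\<dots> = measure_pmf.expectation (srw n)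
      (\<lambda>x. (1 / 2) *\<^sub>R (indicator {x. x - 1 \<in> A} x + indicator {x. x + 1 \<in> A} x))"
    unfolding expectation_srw_Suc by (simp add: indicator_def)
  also have "\<dots> = (measure_pmf.prob (srw n) {x. x - 1 \<in> A} + measure_pmf.prob (srw n) {x. x + 1 \<in> A}) / 2"
    by (simp add: integrable_measure_pmf_finite finite_set_srw)
  finally show ?thesis .
qed

(* By the reflection principle, the probability that the simple random walk reaches level b
   within n steps. *)
definition hitting_prob :: "nat \<Rightarrow> nat \<Rightarrow> real" where
  "hitting_prob n b = measure_pmf.prob (srw n) {x. x \<le> - int b}
     + measure_pmf.prob (srw n) {x. int b < x}"

text \<open>With one tail closed and the other open, the two events are complementary at level
  0.\<close>

lemma hitting_prob_level_0 [simp]: "hitting_prob n 0 = 1"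
proof -
  have "{x. int 0 < x} = - {x. x \<le> - int 0}"
    by auto
  then show ?thesis
    using measure_pmf.prob_compl[of "{x. x \<le> - int 0}" "srw n"]
    by (simp add: hitting_prob_def Compl_eq_Diff_UNIV)
qed

lemma hitting_prob_time_0 [simp]: "hitting_prob 0 b = (if b = 0 then 1 else 0)"
  by (auto simp: hitting_prob_def)

text \<open>The first-step equation of hitting probabilities, obtained by shifting both tails. With
  the values at level 0 and time 0 it identifies \<open>hitting_prob\<close> without reflecting
  paths.\<close>

lemma hitting_prob_Suc:
  assumes "b \<ge> 1"
  shows "hitting_prob (Suc n) b = (hitting_prob n (b + 1) + hitting_prob n (b - 1)) / 2"
proof -
  have "{x. x - 1 \<le> - int b} = {x. x \<le> - int (b - 1)}" "{x. x + 1 \<le> - int b} = {x. x \<le> - int (b + 1)}"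
    "{x. int b < x - 1} = {x. int (b + 1) < x}" "{x. int b < x + 1} = {x. int (b - 1) < x}"
    using assms by (auto simp: of_nat_diff)
  then show ?thesis
    unfolding hitting_prob_def prob_srw_Suc mem_Collect_eq by (simp only:) (simp add: field_simps)
qed

(* The probability that the height of the walk, started at r, vanishes at least a times
   (not counting the initial position) within k steps. A first return to the body takes one step plus the
   time needed to reach level 1, so all a returns together amount to reaching one high level. *)
definition returns_prob :: "nat \<Rightarrow> nat \<Rightarrow> nat \<Rightarrow> real" where
  "returns_prob k r a = (if a = 0 then 1
     else if r = 0 then (if a \<le> k then hitting_prob (k - a) a else 0)
     else (if a - 1 \<le> k then hitting_prob (k - (a - 1)) (r + (a - 1)) else 0))"

lemma returns_prob_time_0: "returns_prob 0 r a = (if a = 0 then 1 else 0)"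
  by (auto simp: returns_prob_def)

lemma returns_prob_step_0: "returns_prob (Suc k) 0 a = returns_prob k 1 a"
  by (cases a) (auto simp: returns_prob_def)

text \<open>For \<open>a > 0\<close> this is \<open>hitting_prob_Suc\<close> at level
  \<open>r + (a - 1)\<close>. A downward step from height 1 is itself a return, which uses up one of
  the \<open>a\<close>.\<close>

lemma returns_prob_step:
  assumes "r \<ge> 1"
  shows "returns_prob (Suc k) r a
    = (returns_prob k (Suc r) a + returns_prob k (r - 1) (if r = 1 then a - 1 else a)) / 2"
proof (cases a)
  case (Suc b)
  have *: "returns_prob k s (Suc b) = (if b \<le> k then hitting_prob (k - b) (s + b) else 0)"
    if "s \<ge> 1" for s k
    using that by (simp add: returns_prob_def)
  have down: "returns_prob k (r - 1) (if r = 1 then a - 1 else a)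
      = (if b \<le> k then hitting_prob (k - b) (r - 1 + b) else 0)"
    using assms Suc by (auto simp: returns_prob_def)
  have up: "returns_prob k (Suc r) a = (if b \<le> k then hitting_prob (k - b) (Suc r + b) else 0)"
    unfolding Suc by (rule *) simp
  have now: "returns_prob (Suc k) r a = (if b \<le> Suc k then hitting_prob (Suc k - b) (r + b) else 0)"
    unfolding Suc by (rule *[OF assms])
  show ?thesis
  proof (cases "b \<le> k")
    case True
    have eq: "r - 1 + b = (r + b) - 1" "Suc r + b = (r + b) + 1" "Suc k - b = Suc (k - b)"
      using assms True by auto
    have "hitting_prob (Suc (k - b)) (r + b)
        = (hitting_prob (k - b) (r + b + 1) + hitting_prob (k - b) (r + b - 1)) / 2"
      using assms by (intro hitting_prob_Suc) simp
    then show ?thesis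
      unfolding now up down unfolding eq using True by simp
  next
    case False
    \<comment> \<open>The truncated difference is 0 here, and no positive level is reached in time
      0.\<close>
    then have "hitting_prob (Suc k - b) (r + b) = 0"
      using assms by simp
    with False show ?thesis
      unfolding now up down by simp
  qed
qed (simp add: returns_prob_def)

text \<open>Only the height matters, so the legs drop out. The start is the first visit, hence more
  than \<open>m\<close> visits means \<open>m\<close> returns from height 0.\<close>

lemma prob_body_visits:
  assumes N: "N \<ge> 1"
  shows "measure_pmf.prob (spider_paths N n) {p. m < body_visits p}
    = (if m \<le> n then hitting_prob (n - m) m else 0)"
proof -
  \<comment> \<open>The number of visits still missing; truncation makes it 0 once
    \<open>m + 1\<close> are reached, and then the probability is 1.\<close>
  define f where "f k p = returns_prob k (height (hd p)) (Suc m - body_visits p)" for k p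
  have "f 0 = indicator {p. m < body_visits p}"
    by (rule ext) (simp add: f_def returns_prob_time_0 indicator_def)
  then have "measure_pmf.prob (spider_paths N n) {p. m < body_visits p}
      = measure_pmf.expectation (spider_paths N n) (f 0)"
    by simp
  also have "\<dots> = f (0 + n) [Body]"
  proof (rule expectation_trajectory_backward)
    fix k n p assume p: "p \<in> set_pmf (spider_paths N n)"
    show "measure_pmf.expectation (spider_step N (hd p)) (\<lambda>y. f k (y # p)) = f (Suc k) p"
      using p N
    proof (cases rule: spider_paths_cases)
      case 1
      have "f k (Leg 1 j # p) = f (Suc k) p" for j
        unfolding f_def by (simp add: 1 returns_prob_step_0)
      then show ?thesis
        unfolding 1 expectation_step_Body[OF N] using N by simp
    next
      case (2 r j)
      have up: "f k (Leg (Suc r) j # p) = returns_prob k (Suc r) (Suc m - body_visits p)"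
        by (simp add: f_def)
      have down: "f k (spider_vertex (r - 1) j # p) = returns_prob k (r - 1)
          (if r = 1 then Suc m - body_visits p - 1 else Suc m - body_visits p)"
        using 2(2) by (simp add: f_def spider_vertex_def)
      have now: "f (Suc k) p = returns_prob (Suc k) r (Suc m - body_visits p)"
        by (simp add: f_def 2(1))
      show ?thesis
        unfolding 2(1) expectation_step_Leg[OF 2(2)] up down now
        by (rule returns_prob_step[OF 2(2), symmetric])
    qed
  qed (use N finite_set_spider_step in blast)
  also have "\<dots> = (if m \<le> n then hitting_prob (n - m) m else 0)"
    by (simp add: f_def returns_prob_def)
  finally show ?thesis .
qed

section \<open>The normal limit of hitting probabilities\<close>

lemma char_srw:
  "char (distr (measure_pmf (srw n)) borel (\<lambda>x. real_of_int x * a)) t = of_real (cos (t * a) ^ n)"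
proof -
  have "measure_pmf.expectation (srw n) (\<lambda>x. exp (\<i> * of_real (t * (real_of_int x * a))))
      = of_real (cos (t * a) ^ n)"
  proof (induction n)
    case (Suc n)
    have "(1 / 2) *\<^sub>R (exp (\<i> * of_real (t * (real_of_int (x - 1) * a)))
          + exp (\<i> * of_real (t * (real_of_int (x + 1) * a))))
        = of_real (cos (t * a)) * exp (\<i> * of_real (t * (real_of_int x * a)))" for x
      unfolding cos_of_real[symmetric] cos_exp_eq
      by (simp add: exp_add[symmetric] exp_diff[symmetric] scaleR_conv_of_real algebra_simps)
    then show ?case
      unfolding expectation_srw_Suc using Suc by simp
  qed simp
  then show ?thesis
    unfolding char_def by (subst integral_distr) auto
qed

text \<open>The power is the exponential of \<open>t \<theta>\<^sup>2\<close> times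
  \<open>ln (cos \<theta>) / \<theta>\<^sup>2\<close>, and the last quotient tends to
  \<open>- 1 / 2\<close>.\<close>

lemma cos_power_tendsto:
  fixes \<theta> :: "nat \<Rightarrow> real" and t :: "nat \<Rightarrow> nat"
  assumes \<theta>: "\<theta> \<longlonglongrightarrow> 0" and lim: "(\<lambda>N. t N * (\<theta> N)\<^sup>2) \<longlonglongrightarrow> u"
  shows "(\<lambda>N. cos (\<theta> N) ^ t N) \<longlonglongrightarrow> exp (- u / 2)"
proof -
  \<comment> \<open>The value at 0 makes the quotient continuous there, so terms with
    \<open>\<theta> N = 0\<close> need no separate treatment.\<close>
  define \<phi> where "\<phi> x = (if x = 0 then - 1 / 2 else ln (cos x) / x\<^sup>2)" for x :: real
  have "((\<lambda>x::real. ln (cos x) / x\<^sup>2) \<longlongrightarrow> - 1 / 2) (at 0)"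
    by real_asymp
  then have "isCont \<phi> 0"
    unfolding isCont_def by (subst tendsto_cong[of _ "\<lambda>x. ln (cos x) / x\<^sup>2"])
      (auto simp: \<phi>_def eventually_at_filter)
  then have "(\<lambda>N. \<phi> (\<theta> N)) \<longlonglongrightarrow> - 1 / 2"
    using isCont_tendsto_compose[OF _ \<theta>, of \<phi>] by (simp add: \<phi>_def)
  then have "(\<lambda>N. exp (t N * (\<theta> N)\<^sup>2 * \<phi> (\<theta> N))) \<longlonglongrightarrow> exp (u * (- 1 / 2))"
    using lim by (intro tendsto_intros)
  moreover have "(\<lambda>N. cos (\<theta> N)) \<longlonglongrightarrow> cos 0"
    by (intro tendsto_intros \<theta>)
  then have "\<forall>\<^sub>F N in sequentially. 0 < cos (\<theta> N)"
    by (rule order_tendstoD) simp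
  then have "\<forall>\<^sub>F N in sequentially. exp (t N * (\<theta> N)\<^sup>2 * \<phi> (\<theta> N)) = cos (\<theta> N) ^ t N"
  proof eventually_elim
    case (elim N)
    have "exp (t N * (\<theta> N)\<^sup>2 * \<phi> (\<theta> N)) = exp (t N * ln (cos (\<theta> N)))"
      by (simp add: \<phi>_def)
    then show ?case
      using elim by (simp add: exp_of_nat_mult)
  qed
  ultimately show ?thesis
    by (auto elim: Lim_transform_eventually)
qed

section \<open>The two-sided tail of the standard normal law\<close>

lemma std_normal_atom: "measure std_normal_distribution {x} = 0"
proof -
  have "emeasure std_normal_distribution {x} = 0"
    by (subst emeasure_density) (auto simp: nn_integral_indicator_singleton' intro!: nn_integral_null_set)
  then show ?thesis
    by (simp add: measure_def)
qed

lemma isCont_std_normal_cdf: "isCont (cdf std_normal_distribution) x"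
proof -
  interpret real_distribution std_normal_distribution
    by (rule real_dist_normal_dist)
  show ?thesis
    unfolding isCont_cdf by (rule std_normal_atom)
qed

text \<open>Written with a closed lower and an open upper tail to match
  \<open>hitting_prob\<close>.\<close>

definition normal_tail :: "real \<Rightarrow> real" where
  "normal_tail x = cdf std_normal_distribution (- x) + (1 - cdf std_normal_distribution x)"

lemma isCont_normal_tail: "isCont normal_tail x"
  unfolding normal_tail_def
  by (intro continuous_intros isCont_o2[OF _ isCont_std_normal_cdf] isCont_std_normal_cdf)

lemma normal_tail_eq:
  assumes Z: "prob_space P" "distributed P lborel Z std_normal_density" and x: "0 < x"
  shows "\<P>(\<omega> in P. \<bar>Z \<omega>\<bar> > x) = normal_tail x"
proof -
  interpret prob_space P by fact
  interpret G: real_distribution std_normal_distribution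
    by (rule real_dist_normal_dist)
  have Zm: "Z \<in> borel_measurable P"
    using distributed_measurable[OF Z(2)] by simp
  have eq: "distr P lborel Z = std_normal_distribution"
    using Z(2) by (simp add: distributed_def)
  have "\<P>(\<omega> in P. \<bar>Z \<omega>\<bar> > x) = measure std_normal_distribution {z. x < \<bar>z\<bar>}"
    unfolding eq[symmetric] using Zm by (subst measure_distr) (auto intro!: arg_cong[where f = prob])
  also have "{z. x < \<bar>z\<bar>} = {..<- x} \<union> {x<..}"
    by auto
  also have "measure std_normal_distribution \<dots>
      = measure std_normal_distribution {..<- x} + measure std_normal_distribution {x<..}"
    using x by (intro G.finite_measure_Union) auto
  finally have 1: "\<P>(\<omega> in P. \<bar>Z \<omega>\<bar> > x)
      = measure std_normal_distribution {..<- x} + measure std_normal_distribution {x<..}" .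
  have "{..- x} = {..<- x} \<union> {- x}"
    by auto
  \<comment> \<open>Passing from the open to the closed ray adds only the null atom at
    \<open>- x\<close>.\<close>
  then have 2: "cdf std_normal_distribution (- x) = measure std_normal_distribution {..<- x}"
    unfolding cdf_def by (simp add: G.finite_measure_Union std_normal_atom del: Un_insert_right)
  have "{x<..} = UNIV - {..x}"
    by auto
  then have 3: "measure std_normal_distribution {x<..} = 1 - cdf std_normal_distribution x"
    unfolding cdf_def using G.prob_compl[of "{..x}"] by simp
  show ?thesis
    unfolding 1 normal_tail_def 2 3 ..
qed

text \<open>A central limit theorem along the times \<open>t N\<close>, via characteristic functions
  and Levy continuity; the limiting cdf is continuous, so convergence holds at every point.\<close>

lemma hitting_prob_tendsto:
  fixes t b :: "nat \<Rightarrow> nat"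
  assumes x: "0 < x" and t: "filterlim t at_top sequentially"
    and lim: "(\<lambda>N. b N / sqrt (t N)) \<longlonglongrightarrow> x"
  shows "(\<lambda>N. hitting_prob (t N) (b N)) \<longlonglongrightarrow> normal_tail x"
proof -
  \<comment> \<open>Scaling by \<open>x / b N\<close>, asymptotically \<open>1 / sqrt (t N)\<close>,
    sends the moving thresholds to the fixed points \<open>x\<close> and \<open>- x\<close>.\<close>
  define \<mu> where "\<mu> N = distr (measure_pmf (srw (t N))) borel (\<lambda>y. real_of_int y * (x / b N))" for N
  have tpos: "\<forall>\<^sub>F N in sequentially. 0 < t N"
    by (rule eventually_compose_filterlim[OF eventually_gt_at_top t])
  have bpos: "\<forall>\<^sub>F N in sequentially. 0 < b N"
    using order_tendstoD(1)[OF lim x] by eventually_elim (auto intro: Nat.gr0I)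
  have sqrt_t: "filterlim (\<lambda>N. sqrt (real (t N))) at_top sequentially"
    using t by (intro filterlim_compose[OF sqrt_at_top] filterlim_compose[OF filterlim_real_sequentially])
  have ratio: "(\<lambda>N. sqrt (t N) / b N) \<longlonglongrightarrow> 1 / x"
    using tendsto_inverse[OF lim] x by (simp add: inverse_eq_divide)
  have "weak_conv_m \<mu> std_normal_distribution"
  proof (rule levy_continuity)
    show "real_distribution (\<mu> N)" for N
      unfolding \<mu>_def by (intro prob_space.real_distribution_distr[OF measure_pmf.prob_space_axioms]) simp
    show "real_distribution std_normal_distribution"
      by (rule real_dist_normal_dist)
    fix s :: real
    have "(\<lambda>N. s * x * (1 / sqrt (t N)) * (sqrt (t N) / b N)) \<longlonglongrightarrow> s * x * 0 * (1 / x)"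
      by (intro tendsto_intros ratio tendsto_divide_0[OF tendsto_const] filterlim_at_top_imp_at_infinity sqrt_t)
    moreover have "\<forall>\<^sub>F N in sequentially.
        s * x * (1 / sqrt (t N)) * (sqrt (t N) / b N) = s * (x / b N)"
      using tpos by eventually_elim simp
    ultimately have 1: "(\<lambda>N. s * (x / b N)) \<longlonglongrightarrow> 0"
      using Lim_transform_eventually by fastforce
    have "(\<lambda>N. (s * x * (sqrt (t N) / b N))\<^sup>2) \<longlonglongrightarrow> (s * x * (1 / x))\<^sup>2"
      by (intro tendsto_intros ratio)
    then have 2: "(\<lambda>N. t N * (s * (x / b N))\<^sup>2) \<longlonglongrightarrow> s\<^sup>2"
      using x by (simp add: power_mult_distrib power_divide mult_ac)
    show "(\<lambda>N. char (\<mu> N) s) \<longlonglongrightarrow> char std_normal_distribution s"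
      unfolding \<mu>_def char_srw char_std_normal_distribution
      using cos_power_tendsto[OF 1 2] by (intro tendsto_of_real) simp
  qed
  then have cdf_lim: "(\<lambda>N. cdf (\<mu> N) y) \<longlonglongrightarrow> cdf std_normal_distribution y" for y
    using isCont_std_normal_cdf by (simp add: weak_conv_m_def weak_conv_def)
  have "(\<lambda>N. cdf (\<mu> N) (- x) + (1 - cdf (\<mu> N) x)) \<longlonglongrightarrow> normal_tail x"
    unfolding normal_tail_def by (intro tendsto_intros cdf_lim)
  moreover have "\<forall>\<^sub>F N in sequentially.
      cdf (\<mu> N) (- x) + (1 - cdf (\<mu> N) x) = hitting_prob (t N) (b N)"
    using bpos
  proof eventually_elim
    case (elim N)
    have cdf_eq: "cdf (\<mu> N) (x * u) = measure_pmf.prob (srw (t N)) {y. real_of_int y \<le> u * b N}"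
      for u :: real
    proof -
      have "real_of_int y * (x / b N) \<le> x * u \<longleftrightarrow> real_of_int y \<le> u * b N" for y
        using x elim by (simp add: field_simps)
      then show ?thesis
        unfolding cdf_def \<mu>_def by (subst measure_distr) (auto simp: vimage_def)
    qed
    have "{y. int (b N) < y} = UNIV - {y. real_of_int y \<le> 1 * real (b N)}"
      by auto
    then have "measure_pmf.prob (srw (t N)) {y. int (b N) < y} = 1 - cdf (\<mu> N) (x * 1)"
      unfolding cdf_eq
      using measure_pmf.prob_compl[of "{y. real_of_int y \<le> 1 * real (b N)}" "srw (t N)"] by simp
    moreover have "{y. y \<le> - int (b N)} = {y. real_of_int y \<le> - 1 * real (b N)}"
      by auto
    then have "measure_pmf.prob (srw (t N)) {y. y \<le> - int (b N)} = cdf (\<mu> N) (x * - 1)"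
      unfolding cdf_eq by simp
    ultimately show ?case
      by (simp add: hitting_prob_def)
  qed
  ultimately show ?thesis
    by (rule Lim_transform_eventually)
qed

section \<open>The covering probability\<close>

lemma climb_event_eq:
  assumes "N \<ge> 1" "L \<ge> 1"
  shows "climb_event N M S n L = {\<omega>\<in>space M. \<forall>j\<in>{1..N}. Leg L j \<in> set (trajectory S n \<omega>)}"
proof -
  have "1 \<le> local_time S (Leg L j) n \<omega> \<longleftrightarrow> Leg L j \<in> set (trajectory S n \<omega>)" for j \<omega>
    by (auto simp: local_time_def set_trajectory Suc_le_eq card_gt_0_iff) metis
  then show ?thesis
    using assms by (auto simp: climb_event_def spider_vertex_def)
qed

lemma prob_climb_event:
  assumes "spider_walk N M S" "N \<ge> 1" "L \<ge> 1"
  shows "measure M (climb_event N M S n L)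
    = measure_pmf.prob (spider_paths N n) {p. \<forall>j\<in>{1..N}. Leg L j \<in> set p}"
  unfolding climb_event_eq[OF assms(2,3)]
  by (rule prob_trajectory[OF assms(1)[unfolded spider_walk_def]])

text \<open>Covering all legs and making more than \<open>m\<close> visits differ only on the two
  rare events bounded by \<open>prob_uncovered\<close> and \<open>prob_covered\<close>.\<close>

lemma prob_climb_bounds:
  assumes "N \<ge> 2" "L \<ge> 1"
  defines "q \<equiv> 1 - 1 / (real N * real L)"
    and "C \<equiv> {p. \<forall>j\<in>{1..N}. Leg L j \<in> set p}"
  shows "measure_pmf.prob (spider_paths N n) {p. m < body_visits p} - N * q ^ m
      \<le> measure_pmf.prob (spider_paths N n) C"
    and "measure_pmf.prob (spider_paths N n) C
      \<le> measure_pmf.prob (spider_paths N n) {p. m < body_visits p} + (1 / q) ^ m / N"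
proof -
  let ?P = "measure_pmf.prob (spider_paths N n)"
  have "?P {p. m < body_visits p}
      \<le> ?P (C \<union> {p. m < body_visits p \<and> (\<exists>j\<in>{1..N}. Leg L j \<notin> set p)})"
    by (intro measure_pmf.finite_measure_mono) (auto simp: C_def)
  also have "\<dots> \<le> ?P C + ?P {p. m < body_visits p \<and> (\<exists>j\<in>{1..N}. Leg L j \<notin> set p)}"
    by (intro measure_Un_le) auto
  finally show "?P {p. m < body_visits p} - N * q ^ m \<le> ?P C"
    using prob_uncovered[OF assms(1,2), of n m] by (simp add: q_def)
  have "?P C \<le> ?P ({p. m < body_visits p} \<union> {p. body_visits p \<le> m \<and> (\<forall>j\<in>{1..N}. Leg L j \<in> set p)})"
    by (intro measure_pmf.finite_measure_mono) (auto simp: C_def)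
  also have "\<dots> \<le> ?P {p. m < body_visits p}
      + ?P {p. body_visits p \<le> m \<and> (\<forall>j\<in>{1..N}. Leg L j \<in> set p)}"
    by (intro measure_Un_le) auto
  finally show "?P C \<le> ?P {p. m < body_visits p} + (1 / q) ^ m / N"
    using prob_covered[OF assms(1,2), of n m] by (simp add: q_def)
qed

section \<open>Asymptotics of the visit count and bounds for the error terms\<close>

lemma floor_asymp:
  fixes K :: "nat \<Rightarrow> real"
  assumes K: "filterlim K at_top sequentially" and "0 \<le> a"
  shows "(\<lambda>N. real (nat \<lfloor>a * K N\<rfloor>) / K N) \<longlonglongrightarrow> a"
proof (rule tendsto_sandwich)
  have pos: "\<forall>\<^sub>F N in sequentially. 0 < K N"
    by (rule eventually_compose_filterlim[OF eventually_gt_at_top K])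
  show "\<forall>\<^sub>F N in sequentially. a - 1 / K N \<le> real (nat \<lfloor>a * K N\<rfloor>) / K N"
    using pos
  proof eventually_elim
    case (elim N)
    have "a * K N - 1 \<le> real (nat \<lfloor>a * K N\<rfloor>)"
      by linarith
    then have "(a * K N - 1) / K N \<le> real (nat \<lfloor>a * K N\<rfloor>) / K N"
      using elim by (intro divide_right_mono) auto
    then show ?case
      using elim by (simp add: diff_divide_distrib)
  qed
  show "\<forall>\<^sub>F N in sequentially. real (nat \<lfloor>a * K N\<rfloor>) / K N \<le> a"
    using pos
  proof eventually_elim
    case (elim N)
    have "real (nat \<lfloor>a * K N\<rfloor>) \<le> a * K N"
      using elim assms(2) by simp
    then show ?case
      using elim by (simp add: field_simps)
  qed
  have "(\<lambda>N. a - 1 / K N) \<longlonglongrightarrow> a - 0"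
    by (intro tendsto_intros tendsto_divide_0[OF tendsto_const] filterlim_at_top_imp_at_infinity K)
  then show "(\<lambda>N. a - 1 / K N) \<longlonglongrightarrow> a"
    by simp
qed simp

text \<open>With \<open>m\<close> of order \<open>a K\<close> and \<open>n\<close> of order
  \<open>(c K)\<^sup>2\<close>, the remaining time \<open>n - m\<close> is still asymptotic to
  \<open>(c K)\<^sup>2\<close>, so the rescaled level tends to \<open>a / c\<close>.\<close>

lemma prob_body_visits_tendsto:
  fixes K :: "nat \<Rightarrow> real"
  assumes K: "filterlim K at_top sequentially" and c: "0 < c" and a: "0 < a"
  shows "(\<lambda>N. measure_pmf.prob (spider_paths N (nat \<lfloor>(c * K N)\<^sup>2\<rfloor>))
      {p. nat \<lfloor>a * K N\<rfloor> < body_visits p}) \<longlonglongrightarrow> normal_tail (a / c)"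
proof -
  define n m where "n N = nat \<lfloor>(c * K N)\<^sup>2\<rfloor>" and "m N = nat \<lfloor>a * K N\<rfloor>" for N
  have pos: "\<forall>\<^sub>F N in sequentially. 0 < K N"
    by (rule eventually_compose_filterlim[OF eventually_gt_at_top K])
  have K2: "filterlim (\<lambda>N. (K N)\<^sup>2) at_top sequentially"
    by (rule filterlim_pow_at_top[OF _ K]) simp
  have m: "(\<lambda>N. m N / K N) \<longlonglongrightarrow> a"
    unfolding m_def using a by (intro floor_asymp K) simp
  have n: "(\<lambda>N. n N / (K N)\<^sup>2) \<longlonglongrightarrow> c\<^sup>2"
    unfolding n_def power_mult_distrib by (intro floor_asymp K2) simp
  have "(\<lambda>N. n N / (K N)\<^sup>2 - m N / K N * (1 / K N)) \<longlonglongrightarrow> c\<^sup>2 - a * 0"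
    by (intro tendsto_intros m n tendsto_divide_0[OF tendsto_const] filterlim_at_top_imp_at_infinity K)
  then have d: "(\<lambda>N. (real (n N) - real (m N)) / (K N)\<^sup>2) \<longlonglongrightarrow> c\<^sup>2"
    by (simp add: diff_divide_distrib power2_eq_square)
  have "\<forall>\<^sub>F N in sequentially. 0 < (real (n N) - real (m N)) / (K N)\<^sup>2"
    using c by (intro order_tendstoD(1)[OF d]) simp
  \<comment> \<open>This selects the nonzero branch of \<open>prob_body_visits\<close> and makes the
    natural subtraction \<open>n N - m N\<close> exact.\<close>
  then have le: "\<forall>\<^sub>F N in sequentially. m N \<le> n N"
  proof eventually_elim
    case (elim N)
    then have "0 < real (n N) - real (m N)"
      by (metis diff_gt_0_iff_gt zero_less_divide_iff zero_le_power2 not_less)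
    then show ?case
      by simp
  qed
  have lim: "filterlim (\<lambda>N. (real (n N) - real (m N)) / (K N)\<^sup>2 * (K N)\<^sup>2) at_top sequentially"
    using c by (intro filterlim_tendsto_pos_mult_at_top[OF d _ K2]) simp
  have eq: "\<forall>\<^sub>F N in sequentially.
      (real (n N) - real (m N)) / (K N)\<^sup>2 * (K N)\<^sup>2 = real (n N - m N)"
    using le pos by eventually_elim (simp add: of_nat_diff)
  have "filterlim (\<lambda>N. real (n N - m N)) at_top sequentially"
    by (rule iffD1[OF filterlim_cong[OF refl refl eq] lim])
  then have t: "filterlim (\<lambda>N. n N - m N) at_top sequentially"
    by (simp add: filterlim_sequentially_iff_filterlim_real)
  have "(\<lambda>N. (m N / K N) / sqrt ((real (n N) - real (m N)) / (K N)\<^sup>2)) \<longlonglongrightarrow> a / sqrt (c\<^sup>2)"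
    using c by (intro tendsto_intros m d) simp
  moreover have "\<forall>\<^sub>F N in sequentially.
      (m N / K N) / sqrt ((real (n N) - real (m N)) / (K N)\<^sup>2) = m N / sqrt (n N - m N)"
    using le pos by eventually_elim (simp add: of_nat_diff real_sqrt_divide)
  ultimately have "(\<lambda>N. m N / sqrt (n N - m N)) \<longlonglongrightarrow> a / sqrt (c\<^sup>2)"
    by (rule Lim_transform_eventually)
  then have "(\<lambda>N. hitting_prob (n N - m N) (m N)) \<longlonglongrightarrow> normal_tail (a / c)"
    using a c by (intro hitting_prob_tendsto t) simp_all
  moreover have "\<forall>\<^sub>F N in sequentially. hitting_prob (n N - m N) (m N)
      = measure_pmf.prob (spider_paths N (n N)) {p. m N < body_visits p}"
    using le eventually_ge_at_top[of 1] by eventually_elim (simp add: prob_body_visits)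
  ultimately show ?thesis
    unfolding n_def[symmetric] m_def[symmetric] by (rule Lim_transform_eventually)
qed

text \<open>Uses \<open>1 - x \<le> exp (- x)\<close>. Rounding the exponent down costs at most
  \<open>1 / (N L)\<close>, which the summand 1 absorbs.\<close>

lemma uncovered_error_bound:
  assumes "N \<ge> 2" "L \<ge> 1"
  shows "real N * (1 - 1 / (real N * real L)) ^ nat \<lfloor>a * (real L * real N * ln N)\<rfloor>
    \<le> exp (1 + (1 - a) * ln N)"
proof -
  let ?m = "nat \<lfloor>a * (real L * real N * ln N)\<rfloor>" and ?x = "1 / (real N * real L)"
  have NL: "1 \<le> real N * real L"
    using mult_mono[of 1 "real N" 1 "real L"] assms by simp
  have "(1 - ?x) ^ ?m \<le> exp (- ?x) ^ ?m"
    using NL exp_ge_add_one_self[of "- ?x"] by (intro power_mono) auto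
  also have "\<dots> = exp (- (?m / (real N * real L)))"
    by (simp add: exp_of_nat_mult[symmetric])
  also have "\<dots> \<le> exp (1 - a * ln N)"
  proof -
    have "a * (real L * real N * ln N) - 1 \<le> ?m"
      by linarith
    then have "a * ln N * (real N * real L) \<le> ?m + real N * real L"
      using NL by (simp add: algebra_simps)
    then have "a * ln N \<le> (?m + real N * real L) / (real N * real L)"
      using NL by (subst pos_le_divide_eq) auto
    then show ?thesis
      using NL assms by (simp add: add_divide_distrib)
  qed
  finally have "real N * (1 - ?x) ^ ?m \<le> exp (ln N) * exp (1 - a * ln N)"
    using assms by simp
  then show ?thesis
    by (simp add: exp_add[symmetric] algebra_simps)
qed

text \<open>With \<open>y = N L\<close>,
  \<open>1 / (1 - 1 / y) = 1 + 1 / (y - 1) \<le> exp (1 / (y - 1))\<close>. Since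
  \<open>y / (y - 1)\<close> decreases in \<open>y \<ge> N\<close>, the bound is uniform in
  \<open>L\<close>.\<close>

lemma covered_error_bound:
  assumes "N \<ge> 2" "L \<ge> 1" "0 \<le> a"
  shows "(1 / (1 - 1 / (real N * real L))) ^ nat \<lfloor>a * (real L * real N * ln N)\<rfloor> / real N
    \<le> exp (a * ln N * (real N / (real N - 1)) - ln N)"
proof -
  let ?m = "nat \<lfloor>a * (real L * real N * ln N)\<rfloor>" and ?y = "real N * real L"
  have NL: "real N \<le> ?y"
    using assms by simp
  have NL1: "1 < real N" "1 < ?y"
    using NL assms(1) by linarith+
  have shift: "1 / (1 - 1 / y) = 1 + 1 / (y - 1)" "y / (y - 1) = 1 + 1 / (y - 1)" if "1 < y" for y :: real
    using that by (simp_all add: field_simps)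
  have "1 / (1 - 1 / ?y) \<le> exp (1 / (?y - 1))"
    unfolding shift(1)[OF NL1(2)] by (rule exp_ge_add_one_self)
  then have "(1 / (1 - 1 / ?y)) ^ ?m \<le> exp (1 / (?y - 1)) ^ ?m"
    using NL1 by (intro power_mono) auto
  also have "\<dots> = exp (?m * (1 / (?y - 1)))"
    by (rule exp_of_nat_mult[symmetric])
  also have "\<dots> \<le> exp (a * ln N * (real N / (real N - 1)))"
  proof -
    have "?m \<le> a * (real L * real N * ln N)"
      using assms by simp
    then have "?m * (1 / (?y - 1)) \<le> a * (real L * real N * ln N) * (1 / (?y - 1))"
      using NL1 by (intro mult_right_mono) auto
    also have "\<dots> = a * ln N * (?y / (?y - 1))"
      by simp
    also have "\<dots> \<le> a * ln N * (real N / (real N - 1))"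
      unfolding shift(2)[OF NL1(1)] shift(2)[OF NL1(2)]
      using NL NL1 assms(3) by (intro mult_left_mono add_left_mono divide_left_mono) auto
    finally show ?thesis
      by simp
  qed
  finally have "(1 / (1 - 1 / ?y)) ^ ?m / real N \<le> exp (a * ln N * (real N / (real N - 1))) / exp (ln N)"
    using assms by (simp add: divide_right_mono)
  then show ?thesis
    by (simp add: exp_diff)
qed

theorem theorem5p2:
  fixes c :: real
    and L :: "nat \<Rightarrow> nat"
    and M :: "nat \<Rightarrow> 'a measure"
    and S :: "nat \<Rightarrow> nat \<Rightarrow> 'a \<Rightarrow> vertex"
    and P :: "'b measure"
    and Z :: "'b \<Rightarrow> real"
  assumes "c > 0"
    and "\<forall>\<^sub>F N in sequentially. 1 \<le> L N \<and> real (L N) \<le> real N / ln (real N)"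
    and "\<And>N. N \<ge> 1 \<Longrightarrow> spider_walk N (M N) (S N)"
    and "prob_space P"
    and "distributed P lborel Z std_normal_density"
  shows "(\<lambda>N. measure (M N)
            (climb_event N (M N) (S N) (nat \<lfloor>(c * real (L N) * real N * ln (real N))\<^sup>2\<rfloor>) (L N)))
          \<longlonglongrightarrow> \<P>(\<omega> in P. \<bar>Z \<omega>\<bar> > 1 / c)"
proof -
  \<comment> \<open>The critical number of body visits for covering; \<open>R a\<close> below is the
    probability of exceeding \<open>a K\<close> visits.\<close>
  define K where "K N = real (L N) * real N * ln N" for N
  define n where "n N = nat \<lfloor>(c * K N)\<^sup>2\<rfloor>" for N
  define R where "R a N = measure_pmf.prob (spider_paths N (n N)) {p. nat \<lfloor>a * K N\<rfloor> < body_visits p}"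
    for a N
  let ?p = "\<lambda>N. measure (M N) (climb_event N (M N) (S N) (n N) (L N))"
  have ev: "\<forall>\<^sub>F N in sequentially. N \<ge> 2 \<and> L N \<ge> 1"
    using assms(2) eventually_ge_at_top[of 2] by eventually_elim simp
  have "filterlim (\<lambda>N. real N * ln N) at_top sequentially"
    by real_asymp
  moreover have "\<forall>\<^sub>F N in sequentially. real N * ln N \<le> K N"
    using ev
  proof eventually_elim
    case (elim N)
    then have "1 * (real N * ln N) \<le> real (L N) * (real N * ln N)"
      by (intro mult_right_mono) auto
    then show ?case
      by (simp add: K_def mult.assoc)
  qed
  ultimately have K: "filterlim K at_top sequentially"
    by (rule filterlim_at_top_mono)
  have R: "R a \<longlonglongrightarrow> normal_tail (a / c)" if "0 < a" for a
    unfolding R_def n_def by (rule prob_body_visits_tendsto[OF K assms(1) that])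
  have lower: "\<forall>\<^sub>F N in sequentially. R a N - exp (1 + (1 - a) * ln N) \<le> ?p N" for a
    using ev
  proof eventually_elim
    case (elim N)
    then show ?case
      using prob_climb_bounds(1)[of N "L N" "n N" "nat \<lfloor>a * K N\<rfloor>"]
        uncovered_error_bound[of N "L N" a] prob_climb_event[of N "M N" "S N" "L N" "n N"] assms(3)[of N]
      by (simp add: R_def K_def)
  qed
  have upper: "\<forall>\<^sub>F N in sequentially.
      ?p N \<le> R a N + exp (a * ln N * (real N / (real N - 1)) - ln N)" if "0 < a" for a
    using ev
  proof eventually_elim
    case (elim N)
    then show ?case
      using prob_climb_bounds(2)[of N "L N" "n N" "nat \<lfloor>a * K N\<rfloor>"] that
        covered_error_bound[of N "L N" a] prob_climb_event[of N "M N" "S N" "L N" "n N"] assms(3)[of N]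
      by (simp add: R_def K_def)
  qed
  \<comment> \<open>The lower error vanishes for \<open>a > 1\<close> and the upper one for
    \<open>0 < a < 1\<close>; continuity at 1 closes the gap between the two.\<close>
  have cont: "((\<lambda>a. normal_tail (a / c)) \<longlongrightarrow> normal_tail (1 / c)) (at 1)"
  proof -
    have "isCont (\<lambda>a. normal_tail (a / c)) 1"
      by (intro isCont_o2[OF _ isCont_normal_tail] continuous_intros) (use assms(1) in simp)
    then show ?thesis
      by (simp add: isCont_def)
  qed
  have "?p \<longlonglongrightarrow> normal_tail (1 / c)"
  proof (rule order_tendstoI)
    fix y assume "y < normal_tail (1 / c)"
    then have "\<forall>\<^sub>F a in at_right 1. y < normal_tail (a / c)"
      by (intro order_tendstoD(1)[OF filterlim_mono[OF cont order_refl]]) (simp_all add: at_le)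
    moreover have "\<forall>\<^sub>F a in at_right (1 :: real). 1 < a"
      by (simp add: eventually_at_right_less)
    ultimately have "\<forall>\<^sub>F a in at_right 1. y < normal_tail (a / c) \<and> 1 < a"
      by eventually_elim simp
    then obtain a where a: "y < normal_tail (a / c)" "1 < a"
      using eventually_happens[of _ "at_right (1 :: real)"] by auto
    have "(\<lambda>N. exp (1 + (1 - a) * ln (real N))) \<longlonglongrightarrow> 0"
      using a(2) by real_asymp
    then have "(\<lambda>N. R a N - exp (1 + (1 - a) * ln (real N))) \<longlonglongrightarrow> normal_tail (a / c) - 0"
      using a by (intro tendsto_intros R) auto
    then have "\<forall>\<^sub>F N in sequentially. y < R a N - exp (1 + (1 - a) * ln (real N))"
      using a by (intro order_tendstoD(1)) auto
    with lower[of a] show "\<forall>\<^sub>F N in sequentially. y < ?p N"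
      by eventually_elim linarith
  next
    fix y assume "normal_tail (1 / c) < y"
    then have "\<forall>\<^sub>F a in at_left 1. normal_tail (a / c) < y"
      by (intro order_tendstoD(2)[OF filterlim_mono[OF cont order_refl]]) (simp_all add: at_le)
    moreover have "\<forall>\<^sub>F a in at_left (1 :: real). a \<in> {0<..<1}"
      by (rule eventually_at_leftI[of 0]) auto
    ultimately have "\<forall>\<^sub>F a in at_left 1. normal_tail (a / c) < y \<and> a \<in> {0<..<1}"
      by eventually_elim simp
    then obtain a where a: "normal_tail (a / c) < y" "0 < a" "a < 1"
      using eventually_happens[of _ "at_left (1 :: real)"] by auto
    have "(\<lambda>N. exp (a * ln (real N) * (real N / (real N - 1)) - ln (real N))) \<longlonglongrightarrow> 0"
    proof (rule filterlim_compose[OF exp_at_bot])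
      have "(\<lambda>N. real N / (real N - 1)) \<longlonglongrightarrow> 1"
        by real_asymp
      \<comment> \<open>This is the coefficient of \<open>ln N\<close> in the exponent; its limit
        \<open>a - 1\<close> is negative.\<close>
      then have "(\<lambda>N. a * (real N / (real N - 1)) - 1) \<longlonglongrightarrow> a * 1 - 1"
        by (intro tendsto_intros)
      moreover have "filterlim (\<lambda>N. ln (real N)) at_top sequentially"
        by real_asymp
      ultimately have "filterlim (\<lambda>N. (a * (real N / (real N - 1)) - 1) * ln (real N)) at_bot sequentially"
        using a(3) by (intro filterlim_tendsto_neg_mult_at_bot) auto
      then show "filterlim (\<lambda>N. a * ln (real N) * (real N / (real N - 1)) - ln (real N)) at_bot sequentially"
        by (simp add: algebra_simps)
    qed
    then have "(\<lambda>N. R a N + exp (a * ln (real N) * (real N / (real N - 1)) - ln (real N)))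
        \<longlonglongrightarrow> normal_tail (a / c) + 0"
      using a by (intro tendsto_intros R) auto
    then have "\<forall>\<^sub>F N in sequentially.
        R a N + exp (a * ln (real N) * (real N / (real N - 1)) - ln (real N)) < y"
      using a by (intro order_tendstoD(2)) auto
    with upper[OF a(2)] show "\<forall>\<^sub>F N in sequentially. ?p N < y"
      by eventually_elim linarith
  qed
  then show ?thesis
    using normal_tail_eq[OF assms(4,5), of "1 / c"] assms(1) by (simp add: n_def K_def mult.assoc)
qed

end
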